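(* Let $\langle A\rangle$ be a GCNS numerical semigroup and let $p$ be a positive divisor of $a$. If $ua+d+k-2\geq \sum_{i=1}^{k-1}s_i$, then $N_{dr,p}(m)$ is increasing in $m\in\mathbb{N}$ for all $0\leq r\leq \frac{a}{p}-1$. Specifically, if $X(rp)=(x_1,\ldots,x_k)$ is the greedy presentation of $rp$, then the Apéry set of $\frac{a}{p}$ in the numerical semigroup $\frac{\langle A\rangle}{p}$ consists of the elements $$N_{dr,p}=\sum_{i=1}^k \frac{a x_i}{p}+r(ua+d)=\left(\sum_{i=1}^k(ub_i+1)x_i\right)\frac{a}{p}+rd\quad\text{for all } 0\leq r\leq \frac{a}{p}-1.$$
   Context: A GCNS numerical semigroup is $\langle A\rangle$ with $A=(a,h_1a+db_1,\ldots,h_ka+db_k)$, where $a,k\geq 2$, $d\in\mathbb{Z}\setminus\{0\}$, $\gcd(a,d)=1$, $b_1=1$, $b_{i+1}=s_ib_i+1$ with $1\leq s_1\leq s_2\leq\cdots\leq s_{k-1}$, $h_i=ub_i+1$ with $u\in\mathbb{Z}^+$, and additionally $h_ia+db_i>1$ for all $i$ when $d<0$. For $p\in\mathbb{Z}^+$, $\frac{\langle A\rangle}{p}=\{x\in\mathbb{N}\mid px\in\langle A\rangle\}$. For $M\in\mathbb{N}$, $O_B^H(M)=\min\{\sum_{i=1}^k h_ix_i\mid \sum_{i=1}^k b_ix_i=M,\ x_i\in\mathbb{N}\}$, and $N_{dr,p}(m):=O_B^H(ma+rp)\cdot\frac{a}{p}+\left(\frac{ma}{p}+r\right)d$ for $m\in\mathbb{N}$.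 $N_{dr,p}$ denotes the smallest element of $\frac{\langle A\rangle}{p}$ congruent to $dr$ modulo $\frac{a}{p}$ (the Apéry set element), and it equals $\min_{m\in\mathbb{N}}N_{dr,p}(m)$. The greedy presentation $X(M)=(x_1,\ldots,x_k)$ of $M$ is the unique solution in $\mathbb{N}^k$ of $\sum_i b_ix_i=M$ with $x_k=\lfloor M/b_k\rfloor$, $x_i\in\{0,1,\ldots,s_i\}$ for $1\leq i\leq k-1$, and such that if $x_i=s_i$ for some $2\leq i\leq k-1$ then $x_1=\cdots=x_{i-1}=0$. *)

theory Defs
  imports Complex_Main "HOL-Number_Theory.Cong"
begin

text \<open>
  Sequences indexed by \<open>1, \<dots>, k\<close> are functions on \<open>nat\<close>; only their values on \<open>{1..k}\<close>
  (for \<open>s\<close>: on \<open>{1..<k}\<close>) matter.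
\<close>

definition gcns ::
  "nat \<Rightarrow> nat \<Rightarrow> int \<Rightarrow> nat \<Rightarrow> (nat \<Rightarrow> nat) \<Rightarrow> (nat \<Rightarrow> nat) \<Rightarrow> (nat \<Rightarrow> nat) \<Rightarrow> bool"
where
  "gcns a k d u s b h \<longleftrightarrow>
     2 \<le> a \<and> 2 \<le> k \<and> d \<noteq> 0 \<and> coprime (int a) d \<and> 1 \<le> u \<and>
     (\<forall>i\<in>{1..<k}. 1 \<le> s i) \<and> (\<forall>i\<in>{1..<k}. \<forall>j\<in>{1..<k}. i \<le> j \<longrightarrow> s i \<le> s j) \<and>
     b 1 = 1 \<and> (\<forall>i\<in>{1..<k}. b (i + 1) = s i * b i + 1) \<and>
     (\<forall>i\<in>{1..k}. h i = u * b i + 1) \<and>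
     (d < 0 \<longrightarrow> (\<forall>i\<in>{1..k}. int (h i) * int a + d * int (b i) > 1))"

text \<open>Under \<^const>\<open>gcns\<close> all generators are positive, so the conversion \<^const>\<open>nat\<close> is exact.\<close>

definition gcns_gens ::
  "nat \<Rightarrow> nat \<Rightarrow> int \<Rightarrow> (nat \<Rightarrow> nat) \<Rightarrow> (nat \<Rightarrow> nat) \<Rightarrow> nat list"
where
  "gcns_gens a k d b h =
     a # map (\<lambda>i. nat (int (h i) * int a + d * int (b i))) [1..<k + 1]"

definition gen_semigroup :: "nat list \<Rightarrow> nat set" where
  "gen_semigroup A = {\<Sum>i<length A. A ! i * y i | y :: nat \<Rightarrow> nat. True}"

definition semigroup_quot :: "nat set \<Rightarrow> nat \<Rightarrow> nat set" where
  "semigroup_quot S p = {x. p * x \<in> S}"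

definition least_cong :: "nat set \<Rightarrow> nat \<Rightarrow> int \<Rightarrow> nat" where
  "least_cong S n c = (LEAST x. x \<in> S \<and> [int x = c] (mod int n))"

definition apery_set :: "nat set \<Rightarrow> nat \<Rightarrow> nat set" where
  "apery_set S n = {least_cong S n (int j) | j. j < n}"

text \<open>\<open>O\<^sub>B\<^sup>H(M)\<close>\<close>

definition opt_val :: "nat \<Rightarrow> (nat \<Rightarrow> nat) \<Rightarrow> (nat \<Rightarrow> nat) \<Rightarrow> nat \<Rightarrow> nat" where
  "opt_val k b h M =
     (LEAST n. \<exists>x :: nat \<Rightarrow> nat. (\<Sum>i=1..k. b i * x i) = M \<and> n = (\<Sum>i=1..k. h i * x i))"

text \<open>
  \<open>N\<^sub>d\<^sub>r\<^sub>,\<^sub>p(m)\<close> and \<open>N\<^sub>d\<^sub>r\<^sub>,\<^sub>p\<close>, for \<open>p\<close> dividing \<open>a\<close>, in which case the divisions are exact.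
\<close>

definition N_fun ::
  "nat \<Rightarrow> nat \<Rightarrow> int \<Rightarrow> (nat \<Rightarrow> nat) \<Rightarrow> (nat \<Rightarrow> nat) \<Rightarrow> nat \<Rightarrow> nat \<Rightarrow> nat \<Rightarrow> int"
where
  "N_fun a k d b h p r m =
     int (opt_val k b h (m * a + r * p)) * int (a div p) + int (m * a div p + r) * d"

definition N_min ::
  "nat \<Rightarrow> nat \<Rightarrow> int \<Rightarrow> (nat \<Rightarrow> nat) \<Rightarrow> (nat \<Rightarrow> nat) \<Rightarrow> nat \<Rightarrow> nat \<Rightarrow> nat"
where
  "N_min a k d b h p r =
     least_cong (semigroup_quot (gen_semigroup (gcns_gens a k d b h)) p) (a div p) (d * int r)"

definition is_greedy ::
  "nat \<Rightarrow> (nat \<Rightarrow> nat) \<Rightarrow> (nat \<Rightarrow> nat) \<Rightarrow> nat \<Rightarrow> (nat \<Rightarrow> nat) \<Rightarrow> bool"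
where
  "is_greedy k s b M x \<longleftrightarrow>
     (\<Sum>i=1..k. b i * x i) = M \<and> x k = M div b k \<and>
     (\<forall>i\<in>{1..<k}. x i \<le> s i) \<and>
     (\<forall>i\<in>{2..<k}. x i = s i \<longrightarrow> (\<forall>j\<in>{1..<i}. x j = 0))"

text \<open>
  The greedy presentation is unique as a \<open>k\<close>-tuple; fixing the value \<open>0\<close> outside \<open>{1..k}\<close>
  makes it unique as a function.
\<close>

definition greedy_pres ::
  "nat \<Rightarrow> (nat \<Rightarrow> nat) \<Rightarrow> (nat \<Rightarrow> nat) \<Rightarrow> nat \<Rightarrow> nat \<Rightarrow> nat"
where
  "greedy_pres k s b M = (THE x. is_greedy k s b M x \<and> (\<forall>i. i \<notin> {1..k} \<longrightarrow> x i = 0))"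

end

theory Submission
  imports Defs
begin

text \<open>
  Since \<open>h\<^sub>i = u b\<^sub>i + 1\<close>, the value \<open>O\<^sub>B\<^sup>H(M)\<close> is \<open>u M\<close> plus the least number of coins from
  \<open>b\<^sub>1, \<dots>, b\<^sub>k\<close> needed to pay \<open>M\<close>. The identity
  \<open>s\<^sub>i b\<^sub>i + b\<^sub>j = b\<^sub>i\<^sub>+\<^sub>1 + s\<^sub>j\<^sub>-\<^sub>1 b\<^sub>j\<^sub>-\<^sub>1\<close> for \<open>j \<le> i\<close> (without the last term if \<open>j = 1\<close>) gives an
  exchange that uses no more coins because \<open>s\<close> is nondecreasing, and that strictly increases
  \<open>\<Sum> b\<^sub>i\<^sup>2 x\<^sub>i\<close>. Hence among the payments with fewest coins the one maximising \<open>\<Sum> b\<^sub>i\<^sup>2 x\<^sub>i\<close> is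
  greedy. A greedy payment of \<open>M\<close> has at most \<open>1 + \<Sum> (s\<^sub>i - 1)\<close> coins below \<open>b\<^sub>k\<close>, while
  any payment of \<open>M' \<ge> M\<close> needs at least \<open>\<lceil>M / b\<^sub>k\<rceil>\<close> coins; so passing from \<open>M\<close> to \<open>M + a\<close>
  lowers the number of coins by at most \<open>\<Sum> (s\<^sub>i - 1) < u a + d\<close>, which is monotonicity of
  \<open>N\<^sub>d\<^sub>r\<^sub>,\<^sub>p\<close>. The elements of the quotient semigroup congruent to \<open>d r\<close> arise from payments of
  \<open>m a + r p\<close>, because \<open>d\<close> is invertible modulo \<open>a\<close>; the least one therefore has \<open>m = 0\<close>.
\<close>

section \<open>Greedy payments\<close>

text \<open>Keeps only the coin system: how few coins pay an amount does not depend on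
  \<open>a\<close>, \<open>d\<close> or \<open>u\<close>.\<close>

locale coin_chain =
  fixes k :: nat and s b :: "nat \<Rightarrow> nat"
  assumes k_pos: "1 \<le> k"
    and s_pos: "\<And>i. 1 \<le> i \<Longrightarrow> i < k \<Longrightarrow> 1 \<le> s i"
    and s_mono: "\<And>i j. 1 \<le> i \<Longrightarrow> i \<le> j \<Longrightarrow> j < k \<Longrightarrow> s i \<le> s j"
    and b_1: "b 1 = 1"
    and b_step: "\<And>i. 1 \<le> i \<Longrightarrow> i < k \<Longrightarrow> b (i + 1) = s i * b i + 1"
begin

definition pays :: "(nat \<Rightarrow> nat) \<Rightarrow> nat \<Rightarrow> bool" where
  "pays x M \<longleftrightarrow> (\<Sum>i=1..k. b i * x i) = M"

definition coins :: "(nat \<Rightarrow> nat) \<Rightarrow> nat" where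
  "coins x = (\<Sum>i=1..k. x i)"

section \<open>Growth of the denominations and existence of payments\<close>

lemma b_less_Suc:
  assumes "1 \<le> i" "i < k"
  shows "b i < b (i + 1)"
proof -
  have "1 * b i \<le> s i * b i"
    using s_pos[OF assms] by (intro mult_right_mono) auto
  then show ?thesis
    using b_step[OF assms] by linarith
qed

lemma b_mono:
  assumes "1 \<le> i" "i \<le> j" "j \<le> k"
  shows "b i \<le> b j"
  using assms(2,3)
proof (induction j rule: dec_induct)
  case (step n)
  then show ?case
    using b_less_Suc[of n] assms(1) by simp
qed simp

lemma b_pos:
  assumes "1 \<le> i" "i \<le> k"
  shows "1 \<le> b i"
  using b_mono[of 1 i] b_1 assms by simp

lemma pays_exists: "\<exists>x. pays x M"
proof
  have "(\<Sum>i=1..k. b i * (if i = 1 then M else 0)) = (\<Sum>i=1..k. if i = 1 then b 1 * M else 0)"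
    by (intro sum.cong) auto
  then show "pays (\<lambda>i. if i = 1 then M else 0) M"
    using k_pos b_1 by (simp add: pays_def)
qed

text \<open>The premises describe the two ways of failing to be greedy: an overfull digit
  (\<open>i = j\<close>), or a coin below a full digit (\<open>j < i\<close>). The number of coins
  changes by \<open>s (j - 1) - s i\<close>, or by \<open>- s i\<close> if \<open>j = 1\<close>; the
  sum weighted by squares is a potential that prevents cycling.\<close>

lemma exchange:
  fixes x :: "nat \<Rightarrow> nat"
  assumes i: "i < k" and j: "1 \<le> j" "j \<le> i"
    and xi: "s i \<le> x i" and xj: "1 \<le> x j" and xij: "i = j \<Longrightarrow> s i < x i"
  obtains y where "(\<Sum>l=1..k. b l * y l) = (\<Sum>l=1..k. b l * x l)"
    and "coins y \<le> coins x"
    and "(\<Sum>l=1..k. b l ^ 2 * x l) < (\<Sum>l=1..k. b l ^ 2 * y l)"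
proof -
  define z where "z l = x l - (if l = i then s i else 0) - (if l = j then 1 else 0)" for l
  \<comment> \<open>For \<open>j = 1\<close> the last summand sits at index 0, outside
    \<open>{1..k}\<close>, so one formula covers both forms of the identity.\<close>
  define y where
    "y l = z l + (if l = i + 1 then 1 else 0) + (if l = j - 1 then s (j - 1) else 0)" for l
  have x_eq: "x l = z l + (if l = i then s i else 0) + (if l = j then 1 else 0)" for l
    using xi xj xij by (auto simp: z_def)
  \<comment> \<open>The weight \<open>f\<close> stays free so that one computation serves the amount
    (\<open>b\<close>), the coins (\<open>1\<close>) and the potential (\<open>b\<close>
    squared).\<close>
  have sum_x: "(\<Sum>l=1..k. f l * x l) = (\<Sum>l=1..k. f l * z l) + f i * s i + f j"
    for f :: "nat \<Rightarrow> nat"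
  proof -
    have "(\<Sum>l=1..k. f l * x l) = (\<Sum>l=1..k. f l * z l + (if l = i then f i * s i else 0)
        + (if l = j then f j else 0))"
      by (intro sum.cong refl, subst x_eq) (simp add: algebra_simps)
    then show ?thesis
      using i j by (simp add: sum.distrib)
  qed
  have sum_y: "(\<Sum>l=1..k. f l * y l) = (\<Sum>l=1..k. f l * z l) + f (i + 1)
      + (if j = 1 then 0 else f (j - 1) * s (j - 1))"
    for f :: "nat \<Rightarrow> nat"
  proof -
    have "(\<Sum>l=1..k. f l * y l) = (\<Sum>l=1..k. f l * z l + (if l = i + 1 then f (i + 1) else 0)
        + (if l = j - 1 then f (j - 1) * s (j - 1) else 0))"
      by (intro sum.cong refl) (simp add: y_def algebra_simps)
    then show ?thesis
      using i j by (auto simp: sum.distrib)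
  qed
  have i1: "1 \<le> i" using j by simp
  have bi: "b (i + 1) = s i * b i + 1" using b_step[OF i1 i] .
  have si: "1 \<le> s i" using s_pos[OF i1 i] .
  have bpos: "1 \<le> b i" using b_pos[of i] i i1 by simp
  have "(\<Sum>l=1..k. b l * y l) = (\<Sum>l=1..k. b l * x l) \<and> coins y \<le> coins x
      \<and> (\<Sum>l=1..k. b l ^ 2 * x l) < (\<Sum>l=1..k. b l ^ 2 * y l)"
  proof (cases "j = 1")
    case True
    have "b i ^ 2 * s i + 1 < b (i + 1) ^ 2"
    proof -
      have "b i ^ 2 * s i * 1 \<le> b i ^ 2 * s i * s i"
        using si by (intro mult_left_mono) auto
      moreover have "b (i + 1) ^ 2 = b i ^ 2 * s i * s i + 2 * (s i * b i) + 1"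
        unfolding bi by (simp add: power2_eq_square algebra_simps)
      moreover have "1 \<le> s i * b i"
        using si bpos by simp
      ultimately show ?thesis by linarith
    qed
    then show ?thesis
      using True bi si b_1 sum_x[of b] sum_y[of b] sum_x[of "\<lambda>_. 1"] sum_y[of "\<lambda>_. 1"]
        sum_x[of "\<lambda>l. b l ^ 2"] sum_y[of "\<lambda>l. b l ^ 2"]
      by (simp add: coins_def)
  next
    case False
    define t where "t = s (j - 1)"
    define c where "c = b (j - 1)"
    have bj: "b j = t * c + 1"
      using b_step[of "j - 1"] j i False by (simp add: t_def c_def)
    have ti: "t \<le> s i"
      using s_mono[of "j - 1" i] j i False by (simp add: t_def)
    have t1: "1 \<le> t"
      using s_pos[of "j - 1"] j i False by (simp add: t_def)
    have "c < b j"
      using b_less_Suc[of "j - 1"] j i False by (simp add: c_def)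
    then have ci: "c < b i"
      using b_mono[of j i] j i by simp
    \<comment> \<open>Expanding both squares and cancelling leaves
      \<open>t * (t - 1) * c ^ 2 + 2 * t * c\<close> against the same expression in
      \<open>s i\<close> and \<open>b i\<close>, which is larger since \<open>t \<le> s i\<close>
      and \<open>c < b i\<close>.\<close>
    have less: "b i ^ 2 * s i + b j ^ 2 < b (i + 1) ^ 2 + c ^ 2 * t"
    proof -
      have "t * (t - 1) * c ^ 2 \<le> s i * (s i - 1) * b i ^ 2"
        using ti ci by (intro mult_mono power_mono) auto
      moreover have "t * c < s i * b i"
      proof -
        have "t * c < t * b i" using t1 ci by simp
        also have "\<dots> \<le> s i * b i" using ti by simp
        finally show ?thesis .
      qed
      moreover have "b j ^ 2 = t * (t - 1) * c ^ 2 + c ^ 2 * t + 2 * (t * c) + 1"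
        using t1 by (cases t) (simp_all add: bj power2_eq_square algebra_simps)
      moreover have "b (i + 1) ^ 2 = s i * (s i - 1) * b i ^ 2 + b i ^ 2 * s i + 2 * (s i * b i) + 1"
        unfolding bi using si by (cases "s i") (simp_all add: power2_eq_square algebra_simps)
      ultimately show ?thesis by linarith
    qed
    show ?thesis
      using False bi bj ti less sum_x[of b] sum_y[of b] sum_x[of "\<lambda>_. 1"] sum_y[of "\<lambda>_. 1"]
        sum_x[of "\<lambda>l. b l ^ 2"] sum_y[of "\<lambda>l. b l ^ 2"]
      by (simp add: coins_def t_def c_def algebra_simps)
  qed
  then show thesis
    using that by blast
qed

section \<open>Reduced payments: digit bounds and uniqueness\<close>

definition reduced :: "(nat \<Rightarrow> nat) \<Rightarrow> bool" where
  "reduced x \<longleftrightarrow> (\<forall>i\<in>{1..<k}. x i \<le> s i) \<and>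
     (\<forall>i\<in>{2..<k}. x i = s i \<longrightarrow> (\<forall>j\<in>{1..<i}. x j = 0))"

lemma reduced_zero_below:
  assumes "reduced x" "Suc j < k" "x (Suc j) = s (Suc j)" "i \<in> {1..j}"
  shows "x i = 0"
proof -
  have "Suc j \<in> {2..<k}" "i \<in> {1..<Suc j}"
    using assms by auto
  then show ?thesis
    using assms unfolding reduced_def by blast
qed

text \<open>A full top digit empties all lower ones and pays exactly \<open>b (j + 1) - 1\<close>;
  otherwise one coin \<open>b j\<close> is to spare, and the lower digits pay less than
  that.\<close>

lemma reduced_partial_sum_less:
  assumes "reduced x" "j < k"
  shows "(\<Sum>i=1..j. b i * x i) < b (j + 1)"
  using assms(2)
proof (induction j)
  case 0
  then show ?case using b_1 by simp
next
  case (Suc j)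
  have b: "b (Suc j + 1) = s (Suc j) * b (Suc j) + 1"
    using b_step[of "Suc j"] Suc.prems by simp
  have le: "x (Suc j) \<le> s (Suc j)"
    using assms(1) Suc.prems by (auto simp: reduced_def)
  show ?case
  proof (cases "x (Suc j) = s (Suc j)")
    case True
    have "(\<Sum>i=1..j. b i * x i) = 0"
      using reduced_zero_below[OF assms(1) Suc.prems True] by simp
    then show ?thesis using True b by simp
  next
    case False
    have IH: "(\<Sum>i=1..j. b i * x i) < b (Suc j)"
      using Suc by simp
    have "b (Suc j) * x (Suc j) + b (Suc j) \<le> s (Suc j) * b (Suc j)"
      using mult_right_mono[of "x (Suc j) + 1" "s (Suc j)" "b (Suc j)"] False le
      by (simp add: algebra_simps)
    then show ?thesis using IH b by simp
  qed
qed

text \<open>At most one digit is full, because it empties those below it; it accounts for the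
  additional 1.\<close>

lemma reduced_coins_below_top:
  assumes "reduced x" "j < k"
  shows "(\<Sum>i=1..j. x i) \<le> 1 + (\<Sum>i=1..j. s i - 1)"
  using assms(2)
proof (induction j)
  case (Suc j)
  have le: "x (Suc j) \<le> s (Suc j)"
    using assms(1) Suc.prems by (auto simp: reduced_def)
  show ?case
  proof (cases "x (Suc j) = s (Suc j)")
    case True
    have "(\<Sum>i=1..j. x i) = 0"
      using reduced_zero_below[OF assms(1) Suc.prems True] by simp
    then show ?thesis using True by simp
  next
    case False
    then show ?thesis using Suc le by simp
  qed
qed simp

lemma sum_split_top: "(\<Sum>i=1..k. f i) = (\<Sum>i=1..k - 1. f i) + f k" for f :: "nat \<Rightarrow> nat"
  using k_pos by (cases k) auto

text \<open>The coins below \<open>b k\<close> of a reduced payment amount to less than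
  \<open>b k\<close>, so \<open>x k\<close> is the quotient.\<close>

lemma is_greedy_iff: "is_greedy k s b M x \<longleftrightarrow> pays x M \<and> reduced x"
proof -
  have "x k = M div b k" if "pays x M" "reduced x"
  proof -
    have "(\<Sum>i=1..k - 1. b i * x i) < b k"
      using reduced_partial_sum_less[OF that(2), of "k - 1"] k_pos by simp
    moreover have "M = (\<Sum>i=1..k - 1. b i * x i) + b k * x k"
      using that(1) sum_split_top[of "\<lambda>i. b i * x i"] by (simp add: pays_def)
    ultimately show ?thesis
      by simp
  qed
  then show ?thesis
    unfolding is_greedy_def pays_def reduced_def by blast
qed

text \<open>Digits are read off from the top: the lower part is a remainder modulo the current
  denomination.\<close>

lemma reduced_unique:
  assumes "reduced x" "reduced y" "j \<le> k"
    and "(\<Sum>i=1..j. b i * x i) = (\<Sum>i=1..j. b i * y i)"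
    and "i \<in> {1..j}"
  shows "x i = y i"
  using assms(3-5)
proof (induction j)
  case (Suc j)
  have lt: "(\<Sum>i=1..j. b i * x i) < b (Suc j)" "(\<Sum>i=1..j. b i * y i) < b (Suc j)"
    using reduced_partial_sum_less[of _ j] assms(1,2) Suc.prems by auto
  have eq: "(\<Sum>i=1..j. b i * x i) + b (Suc j) * x (Suc j)
      = (\<Sum>i=1..j. b i * y i) + b (Suc j) * y (Suc j)"
    using Suc.prems by simp
  have "((\<Sum>i=1..j. b i * x i) + b (Suc j) * x (Suc j)) div b (Suc j) = x (Suc j)"
    "((\<Sum>i=1..j. b i * y i) + b (Suc j) * y (Suc j)) div b (Suc j) = y (Suc j)"
    using lt by simp_all
  then have top: "x (Suc j) = y (Suc j)"
    using eq by simp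
  show ?case
  proof (cases "i = Suc j")
    case False
    then show ?thesis using Suc.IH Suc.prems eq top by simp
  qed (use top in simp)
qed simp

section \<open>Optimality of reduced payments\<close>

lemma optimal_reduced_exists:
  "\<exists>x. pays x M \<and> reduced x \<and> (\<forall>y. pays y M \<longrightarrow> coins x \<le> coins y)"
proof -
  define opt where "opt x \<longleftrightarrow> pays x M \<and> (\<forall>y. pays y M \<longrightarrow> coins x \<le> coins y)" for x
  define W where "W x = (\<Sum>l=1..k. b l ^ 2 * x l)" for x
  obtain x0 where x0: "pays x0 M" using pays_exists by blast
  have "\<exists>x. opt x"
    using ex_has_least_nat[of "\<lambda>x. pays x M" x0 coins] x0 by (auto simp: opt_def)
  then obtain x1 where x1: "opt x1" by blast
  \<comment> \<open>Every coin in use is at most \<open>M\<close>, so each term of \<open>W\<close>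
    is at most \<open>M\<close> times what it pays. This bound guarantees a maximiser.\<close>
  have bound: "W x < M * M + 1" if "opt x" for x
  proof -
    have x: "(\<Sum>i=1..k. b i * x i) = M" using that by (simp add: opt_def pays_def)
    have "b l ^ 2 * x l \<le> M * (b l * x l)" if "l \<in> {1..k}" for l
    proof (cases "x l = 0")
      case False
      have "b l * x l \<le> M"
        using x that member_le_sum[of l "{1..k}" "\<lambda>i. b i * x i"] by simp
      moreover have "b l * 1 \<le> b l * x l"
        using False by (intro mult_left_mono) auto
      ultimately have "b l \<le> M" by linarith
      then show ?thesis by (simp add: power2_eq_square)
    qed simp
    then have "W x \<le> (\<Sum>l=1..k. M * (b l * x l))"
      unfolding W_def by (intro sum_mono)
    also have "\<dots> = M * M"
      using x by (simp add: sum_distrib_left[symmetric])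
    finally show ?thesis by simp
  qed
  obtain x where x: "opt x" and max: "\<And>y. opt y \<Longrightarrow> W y \<le> W x"
    using ex_has_greatest_nat[of opt x1 W "M * M + 1"] x1 bound by fastforce
  \<comment> \<open>An exchange would give another optimal payment with larger
    \<open>W\<close>.\<close>
  have no_exchange: False
    if ij: "i < k" "1 \<le> j" "j \<le> i" "s i \<le> x i" "1 \<le> x j" "i = j \<Longrightarrow> s i < x i" for i j
  proof -
    obtain y where y: "(\<Sum>l=1..k. b l * y l) = (\<Sum>l=1..k. b l * x l)" "coins y \<le> coins x"
      "W x < W y"
      using exchange[where x = x, OF ij] unfolding W_def by blast
    then have "opt y"
      using x by (auto simp: opt_def pays_def intro: order_trans)
    then show False using max y(3) by fastforce
  qed
  have "reduced x"
    unfolding reduced_def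
  proof (intro conjI ballI impI)
    fix i assume "i \<in> {1..<k}"
    then show "x i \<le> s i" using no_exchange[of i i] by force
  next
    fix i j assume "i \<in> {2..<k}" "x i = s i" "j \<in> {1..<i}"
    then show "x j = 0" using no_exchange[of i j] by force
  qed
  then show ?thesis using x by (auto simp: opt_def)
qed

text \<open>By uniqueness, every reduced payment agrees with the optimal one just
  constructed.\<close>

lemma reduced_optimal:
  assumes "pays x M" "reduced x" "pays y M"
  shows "coins x \<le> coins y"
proof -
  obtain z where z: "pays z M" "reduced z" "coins z \<le> coins y"
    using optimal_reduced_exists assms(3) by blast
  have "x i = z i" if "i \<in> {1..k}" for i
    using reduced_unique[of x z k i] assms(1,2) z(1,2) that by (simp add: pays_def)
  then have "coins x = coins z"
    by (simp add: coins_def)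
  then show ?thesis using z(3) by simp
qed

lemma greedy_pres_is_greedy: "is_greedy k s b M (greedy_pres k s b M)"
proof -
  obtain z where z: "pays z M" "reduced z"
    using optimal_reduced_exists by blast
  \<comment> \<open>Cutting off outside \<open>{1..k}\<close> affects neither \<open>pays\<close>
    nor \<open>reduced\<close>, and turns uniqueness of tuples into uniqueness of functions.\<close>
  define x where "x i = (if i \<in> {1..k} then z i else 0)" for i
  have "is_greedy k s b M x"
    using z by (simp add: is_greedy_iff pays_def reduced_def x_def)
  moreover have "y = x"
    if "is_greedy k s b M y \<and> (\<forall>i. i \<notin> {1..k} \<longrightarrow> y i = 0)" for y
  proof
    fix i
    show "y i = x i"
      using that reduced_unique[of y x k i] \<open>is_greedy k s b M x\<close>
      by (cases "i \<in> {1..k}") (auto simp: is_greedy_iff pays_def x_def)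
  qed
  ultimately have "greedy_pres k s b M = x"
    unfolding greedy_pres_def by (intro the_equality) (auto simp: x_def)
  then show ?thesis using \<open>is_greedy k s b M x\<close> by simp
qed

lemma reduced_coins_le:
  assumes "pays x M" "reduced x" "pays y M'" "M \<le> M'"
  shows "coins x \<le> coins y + (\<Sum>i=1..k - 1. s i - 1)"
proof -
  define R where "R = (\<Sum>i=1..k - 1. x i)"
  have coins_x: "coins x = R + x k"
    using sum_split_top[of x] by (simp add: coins_def R_def)
  have "M' \<le> (\<Sum>i=1..k. b k * y i)"
    using assms(3) b_mono by (auto simp: pays_def intro!: sum_mono)
  then have upper: "M \<le> b k * coins y"
    using assms(4) by (simp add: coins_def sum_distrib_left)
  have bk: "0 < b k" using b_pos[of k] k_pos by simp
  have M: "M = (\<Sum>i=1..k - 1. b i * x i) + b k * x k"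
    using assms(1) sum_split_top[of "\<lambda>i. b i * x i"] by (simp add: pays_def)
  show ?thesis
  \<comment> \<open>As soon as a coin below \<open>b k\<close> occurs, \<open>x k < coins y\<close>
    is strict; this absorbs the 1 in \<open>reduced_coins_below_top\<close>.\<close>
  proof (cases "R = 0")
    case True
    have "b k * x k \<le> b k * coins y" using M upper by linarith
    then show ?thesis using True coins_x bk by simp
  next
    case False
    have "R \<le> (\<Sum>i=1..k - 1. b i * x i)"
      unfolding R_def
    proof (intro sum_mono)
      fix i assume "i \<in> {1..k - 1}"
      then have "1 \<le> b i" by (intro b_pos) auto
      then show "x i \<le> b i * x i" by simp
    qed
    then have "b k * x k < b k * coins y" using M upper False by linarith
    then have "x k < coins y" by simp
    then show ?thesis
      using reduced_coins_below_top[OF assms(2), of "k - 1"] coins_x k_pos by (simp add: R_def)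
  qed
qed

section \<open>Evaluation and growth of \<open>opt_val\<close>\<close>

lemma weighted_sum_eq:
  assumes "\<forall>i\<in>{1..k}. h i = u * b i + 1" "pays x M"
  shows "(\<Sum>i=1..k. h i * x i) = u * M + coins x"
proof -
  have "(\<Sum>i=1..k. h i * x i) = (\<Sum>i=1..k. u * (b i * x i) + x i)"
    using assms(1) by (intro sum.cong) (auto simp: algebra_simps)
  then show ?thesis
    using assms(2) by (simp add: sum.distrib sum_distrib_left[symmetric] pays_def coins_def)
qed

lemma opt_val_eq:
  assumes "\<forall>i\<in>{1..k}. h i = u * b i + 1" "pays x M" "reduced x"
  shows "opt_val k b h M = u * M + coins x"
  unfolding opt_val_def
proof (rule Least_equality)
  show "\<exists>x'. (\<Sum>i=1..k. b i * x' i) = M \<and> u * M + coins x = (\<Sum>i=1..k. h i * x' i)"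
    using assms(2) weighted_sum_eq[OF assms(1,2)] by (auto simp: pays_def)
next
  fix n assume "\<exists>x'. (\<Sum>i=1..k. b i * x' i) = M \<and> n = (\<Sum>i=1..k. h i * x' i)"
  then obtain x' where "pays x' M" "n = (\<Sum>i=1..k. h i * x' i)"
    by (auto simp: pays_def)
  then show "u * M + coins x \<le> n"
    using weighted_sum_eq[OF assms(1)] reduced_optimal[OF assms(2,3)] by simp
qed

text \<open>Raising the amount costs \<open>u\<close> per unit and saves only boundedly many coins;
  monotonicity uses the case \<open>M' = M + a\<close>.\<close>

lemma opt_val_le:
  assumes "\<forall>i\<in>{1..k}. h i = u * b i + 1" "M \<le> M'"
  shows "opt_val k b h M + u * (M' - M) \<le> opt_val k b h M' + (\<Sum>i=1..k - 1. s i - 1)"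
proof -
  obtain x y where xy: "pays x M" "reduced x" "pays y M'" "reduced y"
    using optimal_reduced_exists by metis
  have "u * M + u * (M' - M) = u * M'"
    using assms(2) by (simp add: distrib_left[symmetric])
  then show ?thesis
    using reduced_coins_le[OF xy(1-3) assms(2)] opt_val_eq[OF assms(1) xy(1,2)]
      opt_val_eq[OF assms(1) xy(3,4)] by simp
qed

end

section \<open>Generated semigroups and their quotients\<close>

lemma least_cong_cong:
  assumes "[c = c'] (mod int n)"
  shows "least_cong S n c = least_cong S n c'"
proof -
  have "[int x = c] (mod int n) \<longleftrightarrow> [int x = c'] (mod int n)" for x
    using assms cong_trans cong_sym by blast
  then show ?thesis by (simp add: least_cong_def)
qed

text \<open>Multiplication by the unit \<open>d\<close> permutes the residues modulo
  \<open>n\<close>.\<close>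

lemma apery_set_eq_multiples:
  assumes "0 < n" "coprime (int n) d"
  shows "apery_set S n = {least_cong S n (d * int r) | r. r < n}"
proof
  show "apery_set S n \<subseteq> {least_cong S n (d * int r) | r. r < n}"
  proof
    fix y assume "y \<in> apery_set S n"
    then obtain j where j: "j < n" "y = least_cong S n (int j)"
      by (auto simp: apery_set_def)
    obtain e where e: "[d * e = 1] (mod int n)"
      using assms(2) cong_solve_coprime_int[of d "int n"] by (auto simp: coprime_commute)
    define r where "r = nat ((e * int j) mod int n)"
    have r: "int r = (e * int j) mod int n"
      using assms(1) by (simp add: r_def)
    have "[d * int r = d * (e * int j)] (mod int n)"
      unfolding r by (intro cong_mult) (auto simp: cong_def)
    moreover have "[d * (e * int j) = int j] (mod int n)"
      using cong_mult[OF e cong_refl[of "int j"]] by (simp add: mult.assoc)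
    ultimately have "[int j = d * int r] (mod int n)"
      using cong_trans cong_sym by blast
    then have "y = least_cong S n (d * int r)"
      using j least_cong_cong by simp
    moreover have "int r < int n"
      using r assms(1) by simp
    ultimately show "y \<in> {least_cong S n (d * int r) | r. r < n}"
      by auto
  qed
next
  show "{least_cong S n (d * int r) | r. r < n} \<subseteq> apery_set S n"
  proof
    fix y assume "y \<in> {least_cong S n (d * int r) | r. r < n}"
    then obtain r where r: "y = least_cong S n (d * int r)" by blast
    define j where "j = nat ((d * int r) mod int n)"
    have j: "int j = (d * int r) mod int n"
      using assms(1) by (simp add: j_def)
    have "y = least_cong S n (int j)"
      unfolding r by (rule least_cong_cong) (simp add: j cong_def)
    moreover have "int j < int n"
      using j assms(1) by simp
    ultimately show "y \<in> apery_set S n"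
      by (auto simp: apery_set_def)
  qed
qed

text \<open>Separates the multiples of \<open>a\<close> from those of \<open>d\<close>;
  \<open>t\<close> is the coefficient of the generator \<open>a\<close>. Nonnegativity makes the
  conversion \<open>nat\<close> exact.\<close>

lemma gen_semigroup_gcns_gens_iff:
  assumes "\<forall>i\<in>{1..k}. 0 \<le> int (h i) * int a + d * int (b i)"
  shows "x \<in> gen_semigroup (gcns_gens a k d b h) \<longleftrightarrow>
    (\<exists>t (y :: nat \<Rightarrow> nat). int x = int a * (int t + int (\<Sum>i=1..k. h i * y i))
       + d * int (\<Sum>i=1..k. b i * y i))"
proof -
  let ?A = "gcns_gens a k d b h"
  have len: "length ?A = Suc k" by (simp add: gcns_gens_def)
  have sum: "int (\<Sum>i<length ?A. ?A ! i * y i)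
      = int a * (int (y 0) + int (\<Sum>i=1..k. h i * y i)) + d * int (\<Sum>i=1..k. b i * y i)"
    for y :: "nat \<Rightarrow> nat"
  proof -
    have nth: "int (?A ! i) = int (h i) * int a + d * int (b i)" if "i \<in> {1..k}" for i
      using that assms by (cases i) (auto simp: gcns_gens_def simp del: upt_Suc)
    have "(\<Sum>i<length ?A. ?A ! i * y i) = a * y 0 + (\<Sum>i=1..k. ?A ! i * y i)"
      unfolding len lessThan_Suc_atMost atMost_atLeast0
      by (subst sum.atLeast_Suc_atMost) (auto simp: gcns_gens_def simp del: upt_Suc)
    moreover have "int (\<Sum>i=1..k. ?A ! i * y i)
        = (\<Sum>i=1..k. int a * int (h i * y i) + d * int (b i * y i))"
      unfolding of_nat_sum by (intro sum.cong refl) (simp add: nth algebra_simps)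
    ultimately show ?thesis
      by (simp add: sum.distrib sum_distrib_left algebra_simps)
  qed
  show ?thesis
  proof
    assume "x \<in> gen_semigroup ?A"
    then obtain y where "x = (\<Sum>i<length ?A. ?A ! i * y i)"
      by (auto simp: gen_semigroup_def)
    then show "\<exists>t (y :: nat \<Rightarrow> nat). int x = int a * (int t + int (\<Sum>i=1..k. h i * y i))
       + d * int (\<Sum>i=1..k. b i * y i)"
      using sum[of y] by blast
  next
    assume "\<exists>t (y :: nat \<Rightarrow> nat). int x = int a * (int t + int (\<Sum>i=1..k. h i * y i))
       + d * int (\<Sum>i=1..k. b i * y i)"
    then obtain t and y :: "nat \<Rightarrow> nat" where
      ty: "int x = int a * (int t + int (\<Sum>i=1..k. h i * y i)) + d * int (\<Sum>i=1..k. b i * y i)"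
      by blast
    define y' where "y' i = (if i = 0 then t else y i)" for i
    have "(\<Sum>i=1..k. h i * y' i) = (\<Sum>i=1..k. h i * y i)"
      "(\<Sum>i=1..k. b i * y' i) = (\<Sum>i=1..k. b i * y i)"
      by (auto simp: y'_def intro!: sum.cong)
    then have "int x = int (\<Sum>i<length ?A. ?A ! i * y' i)"
      using ty sum[of y'] by (simp add: y'_def)
    then have "x = (\<Sum>i<length ?A. ?A ! i * y' i)"
      by (simp only: of_nat_eq_iff)
    then show "x \<in> gen_semigroup ?A"
      unfolding gen_semigroup_def by blast
  qed
qed

lemma opt_val_lower:
  "opt_val k b h (\<Sum>i=1..k. b i * x i) \<le> (\<Sum>i=1..k. h i * x i)"
  unfolding opt_val_def by (rule Least_le) blast

theorem theorem2p4:
  fixes a k u p :: nat and d :: int and s b h :: "nat \<Rightarrow> nat"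
  assumes "gcns a k d u s b h"
    and "p > 0" and "p dvd a"
    and "int u * int a + d + int k - 2 \<ge> (\<Sum>i=1..k - 1. int (s i))"
  shows "(\<forall>r<a div p. strict_mono (N_fun a k d b h p r)) \<and>
    apery_set (semigroup_quot (gen_semigroup (gcns_gens a k d b h)) p) (a div p)
      = {N_min a k d b h p r | r. r < a div p} \<and>
    (\<forall>r<a div p. \<forall>x. x = greedy_pres k s b (r * p) \<longrightarrow>
       int (N_min a k d b h p r)
         = (\<Sum>i=1..k. int (a * x i div p)) + int r * (int u * int a + d) \<and>
       int (N_min a k d b h p r)
         = (\<Sum>i=1..k. int ((u * b i + 1) * x i)) * int (a div p) + int r * d)"
proof -
  note g = assms(1)[unfolded gcns_def]
  interpret coin_chain k s b
    using g by unfold_locales auto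
  have k2: "2 \<le> k" and cop: "coprime (int a) d" and h: "\<forall>i\<in>{1..k}. h i = u * b i + 1"
    using g by auto
  define n where "n = a div p"
  have a_eq: "a = n * p" using assms(3) by (simp add: n_def)
  then have int_a: "int a = int n * int p" by simp
  have n_pos: "0 < n" using g a_eq by (cases n) auto
  let ?S = "semigroup_quot (gen_semigroup (gcns_gens a k d b h)) p"

  \<comment> \<open>Subtracting 1 from each of the \<open>k - 1\<close> terms turns
    \<open>k - 2\<close> in the hypothesis into \<open>- 1\<close>, hence the strict
    inequality.\<close>
  have "int (\<Sum>i=1..k - 1. s i - 1) = (\<Sum>i=1..k - 1. int (s i) - 1)"
    unfolding of_nat_sum using s_pos by (intro sum.cong) (force simp: of_nat_diff)+
  then have gap: "int (\<Sum>i=1..k - 1. s i - 1) < int u * int a + d"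
    using assms(4) k2 by (simp add: sum_subtractf of_nat_diff)
  then have uad: "0 < int u * int a + d"
    using of_nat_0_le_iff[of "\<Sum>i=1..k - 1. s i - 1"] by linarith
  have gens_nonneg: "\<forall>i\<in>{1..k}. 0 \<le> int (h i) * int a + d * int (b i)"
  proof
    fix i assume "i \<in> {1..k}"
    then have "int (h i) * int a + d * int (b i) = int a + int (b i) * (int u * int a + d)"
      using h by (simp add: algebra_simps)
    then show "0 \<le> int (h i) * int a + d * int (b i)" using uad by simp
  qed

  \<comment> \<open>Monotonicity in \<open>m\<close>\<close>
  have N_fun: "N_fun a k d b h p r m
      = int (opt_val k b h (m * a + r * p)) * int n + int (m * n + r) * d" for r m
  proof -
    have "m * a div p = m * n" using a_eq assms(2) by simp
    then show ?thesis by (simp add: N_fun_def n_def)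
  qed
  \<comment> \<open>A step in \<open>m\<close> raises the amount by \<open>a\<close> and the last
    summand by \<open>n * d\<close>. After division by \<open>n\<close> the gain
    \<open>u * a + d\<close> has to beat the coins saved, which is \<open>gap\<close>.\<close>
  have mono: "strict_mono (N_fun a k d b h p r)" for r
    unfolding strict_mono_Suc_iff
  proof
    fix m
    let ?M = "m * a + r * p"
    have "opt_val k b h ?M + u * a
        \<le> opt_val k b h (Suc m * a + r * p) + (\<Sum>i=1..k - 1. s i - 1)"
      using opt_val_le[OF h, of ?M "Suc m * a + r * p"] by simp
    then have "int (opt_val k b h ?M) + int u * int a
        \<le> int (opt_val k b h (Suc m * a + r * p)) + int (\<Sum>i=1..k - 1. s i - 1)"
      unfolding of_nat_mult[symmetric] of_nat_add[symmetric] by (simp only: of_nat_le_iff)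
    then have "int (opt_val k b h ?M) < int (opt_val k b h (Suc m * a + r * p)) + d"
      using gap by linarith
    then have "int (opt_val k b h ?M) * int n
        < (int (opt_val k b h (Suc m * a + r * p)) + d) * int n"
      using n_pos by (intro mult_strict_right_mono) auto
    then show "N_fun a k d b h p r m < N_fun a k d b h p r (Suc m)"
      by (simp add: N_fun algebra_simps)
  qed

  \<comment> \<open>Apery elements as values at \<open>m = 0\<close>\<close>
  have quot_iff: "x \<in> ?S \<longleftrightarrow> (\<exists>t (y :: nat \<Rightarrow> nat). int p * int x
      = int a * (int t + int (\<Sum>i=1..k. h i * y i)) + d * int (\<Sum>i=1..k. b i * y i))" for x
    using gen_semigroup_gcns_gens_iff[OF gens_nonneg, of "p * x"] by (simp add: semigroup_quot_def)

  have N_min: "int (N_min a k d b h p r) = N_fun a k d b h p r 0" if r: "r < n" for r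
  proof -
    have rp: "r * p < a" using r assms(2) a_eq by simp
    obtain x where x: "pays x (r * p)" "reduced x"
      using optimal_reduced_exists by blast
    have hx: "(\<Sum>i=1..k. h i * x i) = opt_val k b h (r * p)"
      using opt_val_eq[OF h x] weighted_sum_eq[OF h x(1)] by simp
    have bx: "(\<Sum>i=1..k. b i * x i) = r * p"
      using x(1) by (simp add: pays_def)
    have pN: "int p * N_fun a k d b h p r 0 = int a * int (opt_val k b h (r * p)) + d * int (r * p)"
      unfolding N_fun by (simp add: int_a algebra_simps)
    \<comment> \<open>\<open>least_cong\<close> lives in the naturals, so the integer value must
      first be shown nonnegative.\<close>
    have "0 \<le> N_fun a k d b h p r 0"
    proof -
      have "int p * N_fun a k d b h p r 0
          = int a * int (coins x) + int (r * p) * (int u * int a + d)"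
        using pN opt_val_eq[OF h x] by (simp add: algebra_simps)
      also have "\<dots> \<ge> 0" using uad by simp
      finally show ?thesis using assms(2) by (simp add: zero_le_mult_iff)
    qed
    then obtain N where N: "int N = N_fun a k d b h p r 0"
      using nonneg_int_cases by metis
    have "N_min a k d b h p r = N"
      unfolding N_min_def least_cong_def n_def[symmetric]
    proof (rule Least_equality)
      have "N \<in> ?S"
        unfolding quot_iff using pN N hx bx
        by (intro exI[of _ 0] exI[of _ x]) simp
      moreover have "[int N = d * int r] (mod int n)"
        unfolding N by (simp add: N_fun cong_def mult.commute)
      ultimately show "N \<in> ?S \<and> [int N = d * int r] (mod int n)" by blast
    next
      fix z assume z: "z \<in> ?S \<and> [int z = d * int r] (mod int n)"
      then obtain t and y :: "nat \<Rightarrow> nat" where ty: "int p * int z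
          = int a * (int t + int (\<Sum>i=1..k. h i * y i)) + d * int (\<Sum>i=1..k. b i * y i)"
        using quot_iff by blast
      define M where "M = (\<Sum>i=1..k. b i * y i)"
      obtain q where q: "int z = d * int r + int n * q"
        using z by (metis cong_iff_lin cong_sym)
      \<comment> \<open>Multiplying the congruence for \<open>z\<close> by \<open>p\<close> lifts
        the modulus from \<open>n\<close> to \<open>a = n * p\<close>; there \<open>d\<close> can be
        cancelled.\<close>
      have "[d * int M = d * int (r * p)] (mod int a)"
      proof -
        have "d * int M - d * int (r * p)
            = int a * (q - (int t + int (\<Sum>i=1..k. h i * y i)))"
          using ty[folded M_def] q by (simp add: int_a algebra_simps)
        then show ?thesis by (simp add: cong_iff_dvd_diff)
      qed
      then have "[int M = int (r * p)] (mod int a)"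
        using cop by (simp add: cong_mult_lcancel coprime_commute)
      then have "[M = r * p] (mod a)"
        by (simp only: cong_int_iff)
      \<comment> \<open>Since \<open>r * p < a\<close>, it is the remainder itself, so the quotient
        \<open>m\<close> is a natural number.\<close>
      then have "M mod a = r * p"
        using rp by (simp add: cong_def)
      then obtain m where m: "M = m * a + r * p"
        using mult_div_mod_eq[of a M] by (metis mult.commute)
      \<comment> \<open>Dropping the copies of \<open>a\<close> and paying \<open>M\<close>
        optimally can only lower the element.\<close>
      have "opt_val k b h M \<le> t + (\<Sum>i=1..k. h i * y i)"
        using opt_val_lower[of k b h y] by (simp add: M_def)
      then have "int a * int (opt_val k b h M) \<le> int a * (int t + int (\<Sum>i=1..k. h i * y i))"
        unfolding of_nat_add[symmetric]
        by (intro mult_left_mono) (simp_all only: of_nat_le_iff of_nat_0_le_iff)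
      then have "int a * int (opt_val k b h M) + d * int M \<le> int p * int z"
        using ty by (simp add: M_def)
      moreover have "int p * N_fun a k d b h p r m = int a * int (opt_val k b h M) + d * int M"
        unfolding N_fun m by (simp add: int_a algebra_simps)
      ultimately have "N_fun a k d b h p r m \<le> int z"
        using assms(2) by (metis mult_le_cancel_left_pos of_nat_0_less_iff)
      moreover have "N_fun a k d b h p r 0 \<le> N_fun a k d b h p r m"
        using mono[of r] by (simp add: strict_mono_less_eq)
      ultimately show "N \<le> z" using N by linarith
    qed
    then show ?thesis using N by simp
  qed

  \<comment> \<open>Closed forms from the greedy presentation\<close>
  have formula: "int (N_min a k d b h p r)
         = (\<Sum>i=1..k. int (a * x i div p)) + int r * (int u * int a + d) \<and>
       int (N_min a k d b h p r)
         = (\<Sum>i=1..k. int ((u * b i + 1) * x i)) * int n + int r * d"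
    if r: "r < n" and x: "x = greedy_pres k s b (r * p)" for r x
  proof -
    have gx: "pays x (r * p)" "reduced x"
      using greedy_pres_is_greedy[of "r * p"] x by (auto simp: is_greedy_iff)
    have N: "int (N_min a k d b h p r) = int (u * (r * p) + coins x) * int n + int r * d"
      using N_min[OF r] opt_val_eq[OF h gx] by (simp add: N_fun)
    have "a * x i div p = n * x i" for i
      using assms(2) by (simp add: a_eq mult.commute mult.left_commute)
    then have "(\<Sum>i=1..k. int (a * x i div p)) = int n * int (coins x)"
      by (simp add: coins_def sum_distrib_left)
    moreover have "(\<Sum>i=1..k. int ((u * b i + 1) * x i)) = int (u * (r * p) + coins x)"
      using weighted_sum_eq[of "\<lambda>i. u * b i + 1" u, OF _ gx(1)]
      unfolding of_nat_sum[symmetric] by simp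
    \<comment> \<open>The two forms agree because
      \<open>u * (r * p) * n = r * u * a\<close>.\<close>
    ultimately show ?thesis
      using N by (simp add: a_eq algebra_simps)
  qed

  have "coprime (int n) d"
    using cop a_eq by simp
  then have "apery_set ?S n = {N_min a k d b h p r | r. r < n}"
    using apery_set_eq_multiples[OF n_pos] by (simp add: N_min_def n_def)
  then show ?thesis
    using mono formula unfolding n_def[symmetric] by blast
qed

end
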